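(* Let $k \geq 2$, and let $A = \{a_0,a_1,\ldots,a_k\}$ be a finite set of integers such that $0 = a_0 < a_1 < \cdots < a_k$ and $\gcd(A) = 1$. For every positive integer $t$, let \[ h_t = (k-1)(t a_k - 1)a_k + 1. \] Then for every positive integer $t$ there are nonnegative integers $c_t$ and $d_t$ and finite sets $C_t$ and $D_t$ with \[ C_t \subseteq [0, c_t - 2] \quad\text{and}\quad D_t \subseteq [0, d_t - 2] \] such that \[ (hA)^{(t)} = C_t \cup [c_t, h a_k - d_t] \cup (h a_k - D_t) \] for all integers $h \geq h_t$.
   Context: For integers $u,v$, $[u,v] = \{n \in \mathbf{Z} : u \leq n \leq v\}$ (possibly empty). For a set $D$ of integers and an integer $w$, $w - D = \{w - d : d \in D\}$. For a set $A$ of integers and a positive integer $h$, the representation function $r_{A,h}(n)$ is the number of $h$-tuples $(a_{j_1},\ldots,a_{j_h}) \in A^h$ with $a_{j_1} \leq \cdots \leq a_{j_h}$ and $n = \sum_{i=1}^h a_{j_i}$; equivalently, the number of families $(u_a)_{a \in A}$ of nonnegative integers with $\sum_{a\in A} u_a a = n$ and $\sum_{a \in A} u_a = h$. For a positive integer $t$, $(hA)^{(t)} = \{n \in \mathbf{Z} : r_{A,h}(n) \geq t\}$, the set of integers having at least $t$ representations as a sum of $h$ (not necessarily distinct) elements of $A$. *)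

theory Defs
  imports Main
begin

text \<open>
  The number of nondecreasing tuples of length \<open>h\<close> over \<open>A\<close> with sum \<open>n\<close>, a tuple being a list.
  For finite \<open>A\<close> there are only finitely many such lists, so \<^const>\<open>card\<close> is the true count;
  for infinite \<open>A\<close> the count may be infinite, and \<^const>\<open>card\<close> would then return \<open>0\<close>.
\<close>

definition rep_count :: "int set \<Rightarrow> nat \<Rightarrow> int \<Rightarrow> nat" where
  "rep_count A h n =
     card {xs :: int list. length xs = h \<and> set xs \<subseteq> A \<and> sorted xs \<and> sum_list xs = n}"

lemma finite_representations:
  assumes "finite A"
  shows "finite {xs :: int list. length xs = h \<and> set xs \<subseteq> A \<and> sorted xs \<and> sum_list xs = n}"
  by (rule finite_subset[OF _ finite_lists_length_eq[OF assms, of h]]) auto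

text \<open>The set written \<open>(hA)\<^sup>(\<^sup>t\<^sup>)\<close>; the arguments appear in the order \<open>h\<close>, \<open>A\<close>, \<open>t\<close>.\<close>

definition sumset_mult :: "nat \<Rightarrow> int set \<Rightarrow> nat \<Rightarrow> int set" where
  "sumset_mult h A t = {n. rep_count A h n \<ge> t}"

end

theory Submission
  imports Defs "HOL-Library.Multiset"
begin

text \<open>
  Put \<open>m = a\<^sub>k\<close>, \<open>B = A - {0, m}\<close>, \<open>c' = (t m - 1) (\<Sum>b\<in>B. b)\<close> and
  \<open>d' = (t m - 1) (\<Sum>b\<in>B. m - b)\<close>, so that \<open>c' + d' = h\<^sub>t - 1\<close>.
  As \<open>gcd(A) = 1\<close>, every \<open>n\<close> is congruent modulo \<open>m\<close> to some \<open>\<Sum>b\<in>B. x\<^sub>b b\<close>, and the \<open>x\<^sub>b\<close> can be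
  taken in \<open>[s m, (s + 1) m - 1]\<close> for each of \<open>s = 0, \<dots>, t - 1\<close>. If \<open>c' \<le> n \<le> h m - d'\<close>, then
  the multiplicities of \<open>m\<close> and \<open>0\<close> needed to complete this to a representation of \<open>n\<close> with \<open>h\<close>
  summands are nonnegative, which gives \<open>t\<close> representations.
  For \<open>n \<le> h\<close> the number of representations does not depend on \<open>h\<close>, because a further summand has
  to be \<open>0\<close>; hence the part of \<open>(hA)\<^sup>(\<^sup>t\<^sup>)\<close> below \<open>c'\<close> is constant for \<open>h \<ge> c'\<close>. The part above
  \<open>h m - d'\<close> is treated in the same way after the reflection \<open>x \<mapsto> m - x\<close> of \<open>A\<close>.
\<close>

section \<open>Representations as multisets\<close>

text \<open>Multisets replace sorted lists so that adding a summand or reflecting all summands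
  requires no re-sorting.\<close>

definition rep_msets :: "int set \<Rightarrow> nat \<Rightarrow> int \<Rightarrow> int multiset set" where
  "rep_msets A h n = {M. set_mset M \<subseteq> A \<and> size M = h \<and> sum_mset M = n}"

lemma bij_betw_mset_rep_msets:
  "bij_betw mset {xs. length xs = h \<and> set xs \<subseteq> A \<and> sorted xs \<and> sum_list xs = n} (rep_msets A h n)"
proof (rule bij_betw_byWitness[where f' = sorted_list_of_multiset])
  show "sorted_list_of_multiset ` rep_msets A h n
      \<subseteq> {xs. length xs = h \<and> set xs \<subseteq> A \<and> sorted xs \<and> sum_list xs = n}"
  proof clarify
    fix M assume M: "M \<in> rep_msets A h n"
    have "mset (sorted_list_of_multiset M) = M"
      by simp
    then have "size M = length (sorted_list_of_multiset M)"
      and "sum_mset M = sum_list (sorted_list_of_multiset M)"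
      by (metis size_mset, metis sum_mset_sum_list)
    with M show "length (sorted_list_of_multiset M) = h \<and> set (sorted_list_of_multiset M) \<subseteq> A \<and>
        sorted (sorted_list_of_multiset M) \<and> sum_list (sorted_list_of_multiset M) = n"
      by (simp add: rep_msets_def)
  qed
qed (auto simp: rep_msets_def sum_mset_sum_list sorted_sort_id)

lemma rep_count_eq_card_rep_msets: "rep_count A h n = card (rep_msets A h n)"
  unfolding rep_count_def by (rule bij_betw_same_card[OF bij_betw_mset_rep_msets])

lemma finite_rep_msets: "finite A \<Longrightarrow> finite (rep_msets A h n)"
  using bij_betw_finite[OF bij_betw_mset_rep_msets] finite_representations by blast

section \<open>Stability in the number of summands, and reflection\<close>

lemma sum_mset_lower_bound:
  fixes M :: "int multiset"
  assumes "\<And>x. x \<in># M \<Longrightarrow> l \<le> x"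
  shows "int (size M) * l \<le> sum_mset M"
  using assms by (induction M) (auto simp: algebra_simps add_mono)

lemma sum_mset_reflect:
  fixes M :: "int multiset"
  shows "(\<Sum>x\<in>#M. m - x) = int (size M) * m - sum_mset M"
  by (induction M) (auto simp: algebra_simps)

text \<open>If all \<open>Suc h\<close> summands were positive, their sum would exceed
  \<open>h\<close>, hence \<open>n\<close>. So some summand is 0, and removing one copy of it
  inverts \<open>add_mset 0\<close>.\<close>

lemma rep_count_Suc:
  assumes "A \<subseteq> {0..}" "0 \<in> A" "n \<le> int h"
  shows "rep_count A (Suc h) n = rep_count A h n"
proof -
  have "rep_msets A (Suc h) n = add_mset 0 ` rep_msets A h n"
  proof (intro equalityI subsetI)
    fix M assume M: "M \<in> rep_msets A (Suc h) n"
    have "0 \<in># M"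
    proof (rule ccontr)
      assume "0 \<notin># M"
      then have "1 \<le> x" if "x \<in># M" for x
        using that M assms(1) by (force simp: rep_msets_def int_one_le_iff_zero_less less_le)
      then have "int (size M) * 1 \<le> sum_mset M"
        by (rule sum_mset_lower_bound)
      then show False
        using M assms(3) by (simp add: rep_msets_def)
    qed
    then obtain N where "M = add_mset 0 N"
      by (metis mset_add)
    then show "M \<in> add_mset 0 ` rep_msets A h n"
      using M by (auto simp: rep_msets_def)
  qed (use assms(2) in \<open>auto simp: rep_msets_def\<close>)
  moreover have "inj_on (add_mset (0::int)) X" for X
    by (auto intro: inj_onI)
  ultimately show ?thesis
    by (simp add: rep_count_eq_card_rep_msets card_image)
qed

lemma rep_count_stable:
  assumes "A \<subseteq> {0..}" "0 \<in> A" "n \<le> int g" "g \<le> h"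
  shows "rep_count A h n = rep_count A g n"
  using assms(4,3)
proof (induction rule: dec_induct)
  case (step i)
  then show ?case using rep_count_Suc[OF assms(1,2), of n i] by simp
qed simp

text \<open>The map \<open>x \<mapsto> m - x\<close>, applied to each summand, is an involution that
  turns a sum \<open>n\<close> of \<open>h\<close> terms into \<open>h * m - n\<close>.\<close>

lemma rep_count_reflect:
  "rep_count ((-) m ` A) h (int h * m - n) = rep_count A h n"
proof -
  have "bij_betw (image_mset ((-) m)) (rep_msets A h n) (rep_msets ((-) m ` A) h (int h * m - n))"
    by (rule bij_betw_byWitness[where f' = "image_mset ((-) m)"])
      (auto 0 4 simp: rep_msets_def multiset.map_comp comp_def sum_mset_reflect)
  then show ?thesis
    by (simp add: rep_count_eq_card_rep_msets bij_betw_same_card)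
qed

lemma rep_count_eq_0:
  assumes "A \<subseteq> {0..m}" "n \<notin> {0..int h * m}"
  shows "rep_count A h n = 0"
proof -
  have "0 \<le> sum_mset M \<and> sum_mset M \<le> int h * m" if M: "set_mset M \<subseteq> A" "size M = h" for M
  proof
    show "0 \<le> sum_mset M"
      using sum_mset_lower_bound[of M 0] M assms(1) by fastforce
    \<comment> \<open>The upper bound is the lower bound 0 for the reflected multiset.\<close>
    have "int (size (image_mset ((-) m) M)) * 0 \<le> (\<Sum>x\<in>#M. m - x)"
      by (rule sum_mset_lower_bound) (use M assms(1) in auto)
    then show "sum_mset M \<le> int h * m"
      using M(2) by (simp add: sum_mset_reflect)
  qed
  then have "rep_msets A h n = {}"
    using assms(2) by (auto simp: rep_msets_def)
  then show ?thesis
    by (simp add: rep_count_eq_card_rep_msets)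
qed

section \<open>Many representations in the middle range\<close>

text \<open>Induction on \<open>A\<close>: the two-term identity for \<open>b\<close> and
  \<open>Gcd B\<close> multiplies all earlier coefficients by \<open>v\<close>.\<close>

lemma Bezout_Gcd:
  fixes A :: "int set"
  assumes "finite A"
  shows "\<exists>y. (\<Sum>a\<in>A. y a * a) = Gcd A"
  using assms
proof (induction A)
  case (insert b B)
  then obtain y where y: "(\<Sum>a\<in>B. y a * a) = Gcd B" by blast
  obtain u v where uv: "u * b + v * Gcd B = gcd b (Gcd B)"
    using bezout_int by blast
  have "(\<Sum>a\<in>insert b B. (if a = b then u else v * y a) * a) = u * b + (\<Sum>a\<in>B. v * (y a * a))"
    using insert by (simp, intro sum.cong) (auto simp: mult.assoc)
  also have "\<dots> = Gcd (insert b B)"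
    by (simp add: y uv flip: sum_distrib_left)
  finally show ?case by (rule exI[of _ "\<lambda>a. if a = b then u else v * y a"])
qed simp

lemma
  fixes f :: "int \<Rightarrow> nat"
  assumes "finite B"
  shows size_sum_replicate_mset: "size (\<Sum>b\<in>B. replicate_mset (f b) b) = (\<Sum>b\<in>B. f b)"
    and sum_mset_sum_replicate_mset:
      "sum_mset (\<Sum>b\<in>B. replicate_mset (f b) b) = (\<Sum>b\<in>B. int (f b) * b)"
    and count_sum_replicate_mset:
      "count (\<Sum>b\<in>B. replicate_mset (f b) b) c = (if c \<in> B then f c else 0)"
    and set_mset_sum_replicate_mset:
      "set_mset (\<Sum>b\<in>B. replicate_mset (f b) b) \<subseteq> B"
  using assms by (induction B) auto

text \<open>The block index \<open>s\<close> is encoded in the representation as the quotient by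
  \<open>m\<close> of the multiplicity of each \<open>b\<close> in \<open>B\<close>, so that
  different \<open>s\<close> can be told apart later.\<close>

lemma rep_in_residue_block:
  fixes A :: "int set" and m :: int
  defines "B \<equiv> A - {0, m}"
  assumes A: "finite A" "0 \<in> A" "m \<in> A" "A \<subseteq> {0..m}" "Gcd A = 1" and "0 < m"
    and "s < t"
    and lo: "(int t * m - 1) * (\<Sum>b\<in>B. b) \<le> n"
    and hi: "n \<le> int h * m - (int t * m - 1) * (\<Sum>b\<in>B. m - b)"
  shows "\<exists>M \<in> rep_msets A h n. \<forall>b\<in>B. int (count M b) div m = int s"
proof -
  obtain y where y: "(\<Sum>a\<in>A. y a * a) = 1"
    using Bezout_Gcd[OF A(1)] A(5) by auto
  \<comment> \<open>The Bezout coefficient of \<open>b\<close>, scaled by \<open>n\<close>, is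
    reduced modulo \<open>m\<close> and then shifted into block \<open>s\<close>; neither operation
    changes its class modulo \<open>m\<close>.\<close>
  define x where "x b = int s * m + (n * y b) mod m" for b
  have x_ge: "0 \<le> x b" for b
    using \<open>0 < m\<close> by (simp add: x_def)
  have x_div: "x b div m = int s" for b
    using \<open>0 < m\<close> by (simp add: x_def)
  have x_le: "x b \<le> int t * m - 1" for b
  proof -
    have "(int s + 1) * m \<le> int t * m"
      using \<open>s < t\<close> \<open>0 < m\<close> by (intro mult_right_mono) auto
    then show ?thesis
      using pos_mod_bound[OF \<open>0 < m\<close>, of "n * y b"] by (simp add: x_def algebra_simps)
  qed
  have fB: "finite B" using A(1) by (simp add: B_def)
  have Bm: "0 \<le> b" "b \<le> m" if "b \<in> B" for b
    using that A(4) by (auto simp: B_def)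
  \<comment> \<open>In the Bezout identity multiplied by \<open>n\<close>, the terms of 0 and
    \<open>m\<close> vanish modulo \<open>m\<close>, leaving only the sum over
    \<open>B\<close>.\<close>
  have "m dvd n - (\<Sum>b\<in>B. x b * b)"
  proof -
    have "A = insert 0 (insert m B)" "0 \<notin> B" "m \<notin> B" using A by (auto simp: B_def)
    then have "(\<Sum>a\<in>A. y a * a) = y m * m + (\<Sum>b\<in>B. y b * b)"
      using \<open>0 < m\<close> fB by simp
    then have "n = n * (y m * m + (\<Sum>b\<in>B. y b * b))"
      using y by simp
    then have "n - (\<Sum>b\<in>B. x b * b) = n * y m * m + (\<Sum>b\<in>B. (n * y b - x b) * b)"
      by (simp add: algebra_simps sum_distrib_left sum_subtractf)
    moreover have "m dvd n * y b - x b" for b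
    proof -
      have "n * y b - x b = (n * y b - n * y b mod m) - int s * m" by (simp add: x_def)
      then show ?thesis by (simp only: dvd_diff dvd_minus_mod dvd_triv_right)
    qed
    ultimately show ?thesis
      by (simp add: dvd_sum)
  qed
  then obtain v where v: "n - (\<Sum>b\<in>B. x b * b) = m * v" by (elim dvdE)
  \<comment> \<open>\<open>v\<close> will be the multiplicity of \<open>m\<close>; \<open>w\<close>
    is the number of zeros that brings the total to \<open>h\<close> summands.\<close>
  define w where "w = int h - (\<Sum>b\<in>B. x b) - v"
  have "(\<Sum>b\<in>B. x b * b) \<le> (int t * m - 1) * (\<Sum>b\<in>B. b)"
    unfolding sum_distrib_left by (intro sum_mono mult_right_mono x_le Bm)
  with lo v have "0 \<le> m * v" by linarith
  then have v0: "0 \<le> v" using \<open>0 < m\<close> by (simp add: zero_le_mult_iff)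
  have "(\<Sum>b\<in>B. x b * (m - b)) \<le> (int t * m - 1) * (\<Sum>b\<in>B. m - b)"
    unfolding sum_distrib_left by (intro sum_mono mult_right_mono x_le) (use Bm in auto)
  \<comment> \<open>Reflection exchanges the roles of 0 and \<open>m\<close>: \<open>w\<close>
    counts the copies of \<open>m\<close> in the reflected representation of
    \<open>h * m - n\<close>, so \<open>hi\<close> does for \<open>w\<close> what \<open>lo\<close>
    did for \<open>v\<close>.\<close>
  moreover have "m * w = int h * m - n - (\<Sum>b\<in>B. x b * (m - b))"
    using v by (simp add: w_def algebra_simps sum_subtractf sum_distrib_left)
  ultimately have "0 \<le> m * w" using hi by linarith
  then have w0: "0 \<le> w" using \<open>0 < m\<close> by (simp add: zero_le_mult_iff)
  define M where "M = (\<Sum>b\<in>B. replicate_mset (nat (x b)) b)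
      + replicate_mset (nat v) m + replicate_mset (nat w) 0"
  have "set_mset M \<subseteq> A"
    using A set_mset_sum_replicate_mset[OF fB, of "\<lambda>b. nat (x b)"]
    by (auto simp: M_def B_def split: if_splits)
  moreover have "int (size M) = int h"
    using v0 w0 x_ge by (simp add: M_def size_sum_replicate_mset[OF fB] w_def)
  moreover have "sum_mset M = n"
    using v v0 x_ge by (simp add: M_def sum_mset_sum_replicate_mset[OF fB] algebra_simps)
  moreover have "int (count M b) = x b" if "b \<in> B" for b
  proof -
    have "b \<noteq> 0" "b \<noteq> m" using that by (auto simp: B_def)
    then show ?thesis
      using that x_ge by (simp add: M_def count_sum_replicate_mset[OF fB])
  qed
  ultimately show ?thesis
    using x_div by (intro bexI[of _ M]) (auto simp: rep_msets_def)
qed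

text \<open>For one fixed \<open>b\<close> in \<open>B\<close>, the quotient of its multiplicity by
  \<open>m\<close> recovers \<open>s\<close>, so the representations chosen for \<open>s < t\<close>
  are pairwise distinct.\<close>

lemma rep_count_ge_middle:
  fixes A :: "int set" and m :: int
  defines "B \<equiv> A - {0, m}"
  assumes A: "finite A" "0 \<in> A" "m \<in> A" "A \<subseteq> {0..m}" "Gcd A = 1" and "0 < m" "B \<noteq> {}"
    and lo: "(int t * m - 1) * (\<Sum>b\<in>B. b) \<le> n"
    and hi: "n \<le> int h * m - (int t * m - 1) * (\<Sum>b\<in>B. m - b)"
  shows "t \<le> rep_count A h n"
proof -
  obtain b where b: "b \<in> B" using \<open>B \<noteq> {}\<close> by blast
  have "\<exists>M. M \<in> rep_msets A h n \<and> int (count M b) div m = int s" if "s < t" for s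
    using rep_in_residue_block[OF A \<open>0 < m\<close> that] lo hi b unfolding B_def by blast
  then obtain M where M: "\<And>s. s < t \<Longrightarrow> M s \<in> rep_msets A h n"
      "\<And>s. s < t \<Longrightarrow> int (count (M s) b) div m = int s"
    by metis
  have "inj_on M {..<t}"
    by (rule inj_onI) (metis M(2) lessThan_iff of_nat_eq_iff)
  moreover have "M ` {..<t} \<subseteq> rep_msets A h n"
    using M(1) by auto
  ultimately have "card {..<t} \<le> card (rep_msets A h n)"
    using finite_rep_msets[OF A(1)] by (rule card_inj_on_le)
  then show ?thesis by (simp add: rep_count_eq_card_rep_msets)
qed

section \<open>Separating the two ends from the interval\<close>

text \<open>Take \<open>c\<close> least such that \<open>P\<close> holds on all of
  \<open>{int c..c'}\<close>. By minimality \<open>P\<close> fails at \<open>int c - 1\<close> when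
  \<open>c\<close> is positive, which is why \<open>C\<close> ends at
  \<open>int c - 2\<close>.\<close>

lemma initial_part_decomposition:
  fixes P :: "int \<Rightarrow> bool" and c' :: int
  assumes "0 \<le> c'" "P c'"
  shows "\<exists>(c::nat) C. finite C \<and> C \<subseteq> {0..int c - 2} \<and> int c \<le> c' \<and>
    (\<forall>n\<in>{0..c'}. P n \<longleftrightarrow> n \<in> C \<or> int c \<le> n)"
proof -
  define c where "c = (LEAST c::nat. \<forall>n\<in>{int c..c'}. P n)"
  have *: "\<forall>n\<in>{int (nat c')..c'}. P n" using assms by auto
  have c: "\<forall>n\<in>{int c..c'}. P n" unfolding c_def by (rule LeastI[of "\<lambda>c. \<forall>n\<in>{int c..c'}. P n", OF *])
  have cle: "int c \<le> c'" using Least_le[of "\<lambda>c. \<forall>n\<in>{int c..c'}. P n", OF *] assms(1)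
    by (simp add: c_def)
  have last: "\<not> P (int c - 1)" if "0 < c"
  proof
    assume "P (int c - 1)"
    have "P n" if "n \<in> {int (c - 1)..c'}" for n
      using that c \<open>P (int c - 1)\<close> \<open>0 < c\<close> by (cases "n = int c - 1") auto
    then have *: "\<forall>n\<in>{int (c - 1)..c'}. P n" by blast
    have "c \<le> c - 1"
      using Least_le[of "\<lambda>c. \<forall>n\<in>{int c..c'}. P n", OF *] by (simp only: c_def[symmetric])
    with that show False by simp
  qed
  have gap: "n \<le> int c - 2" if "0 \<le> n" "n < int c" "P n" for n
    using last that by (cases "n = int c - 1") auto
  define C where "C = {n\<in>{0..int c - 2}. P n}"
  have "C \<subseteq> {0..int c - 2}" by (auto simp: C_def)
  moreover from this have "finite C" by (rule finite_subset) simp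
  moreover have "\<forall>n\<in>{0..c'}. P n \<longleftrightarrow> n \<in> C \<or> int c \<le> n"
    using c gap by (fastforce simp: C_def)
  ultimately show ?thesis using cle by blast
qed

text \<open>Both ends are read off at the single value \<open>H = c' + d'\<close>, \<open>C\<close>
  from \<open>A\<close> and \<open>D\<close> from the reflected set \<open>A'\<close>, and stability
  carries them to every larger \<open>h\<close>.\<close>

lemma sumset_mult_structure:
  fixes A :: "int set" and m :: int and t :: nat
  defines "B \<equiv> A - {0, m}"
  defines "c' \<equiv> (int t * m - 1) * (\<Sum>b\<in>B. b)"
    and "d' \<equiv> (int t * m - 1) * (\<Sum>b\<in>B. m - b)"
  assumes A: "finite A" "0 \<in> A" "m \<in> A" "A \<subseteq> {0..m}" "Gcd A = 1" and "0 < m" "B \<noteq> {}" "1 \<le> t"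
  shows "\<exists>(c::nat) (d::nat) C D. finite C \<and> finite D \<and>
      C \<subseteq> {0..int c - 2} \<and> D \<subseteq> {0..int d - 2} \<and>
      (\<forall>h::nat. c' + d' \<le> int h \<longrightarrow> sumset_mult h A t =
        C \<union> {int c..int h * m - int d} \<union> (\<lambda>x. int h * m - x) ` D)"
proof -
  define A' where "A' = (-) m ` A"
  define H where "H = nat (c' + d')"
  have "1 * 1 \<le> int t * m" using \<open>1 \<le> t\<close> \<open>0 < m\<close> by (intro mult_mono) auto
  moreover have "0 \<le> (\<Sum>b\<in>B. b)" "0 \<le> (\<Sum>b\<in>B. m - b)"
    using A(4) by (auto simp: B_def intro!: sum_nonneg)
  ultimately have nonneg: "0 \<le> c'" "0 \<le> d'"
    by (simp_all add: c'_def d'_def)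
  have middle: "t \<le> rep_count A h n" if "c' \<le> n" "n \<le> int h * m - d'" for h n
    using that rep_count_ge_middle[OF A \<open>0 < m\<close>] \<open>B \<noteq> {}\<close> unfolding B_def c'_def d'_def by blast
  have h_le: "int h \<le> int h * m" for h
    using \<open>0 < m\<close> by (simp add: mult_le_cancel_left1)
  have Hcd: "int H = c' + d'" using nonneg by (simp add: H_def)
  have reflect: "rep_count A h n = rep_count A' h (int h * m - n)" for h n
    unfolding A'_def by (rule rep_count_reflect[symmetric])
  \<comment> \<open>The point \<open>c'\<close> lies in the middle range because
    \<open>c' + d' = H \<le> H * m\<close>.\<close>
  have "t \<le> rep_count A H c'"
    by (rule middle) (use h_le[of H] Hcd in linarith)+
  then obtain c C where C: "finite C" "C \<subseteq> {0..int c - 2}" "int c \<le> c'"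
      "\<forall>n\<in>{0..c'}. t \<le> rep_count A H n \<longleftrightarrow> n \<in> C \<or> int c \<le> n"
    using initial_part_decomposition[of c' "\<lambda>n. t \<le> rep_count A H n"] nonneg by blast
  have "t \<le> rep_count A H (int H * m - d')"
    by (rule middle) (use h_le[of H] Hcd in linarith)+
  then have "t \<le> rep_count A' H d'"
    by (simp add: reflect)
  then obtain d D where D: "finite D" "D \<subseteq> {0..int d - 2}" "int d \<le> d'"
      "\<forall>n\<in>{0..d'}. t \<le> rep_count A' H n \<longleftrightarrow> n \<in> D \<or> int d \<le> n"
    using initial_part_decomposition[of d' "\<lambda>n. t \<le> rep_count A' H n"] nonneg by blast
  have low: "rep_count A h n = rep_count A H n" if "c' + d' \<le> int h" "n \<le> c'" for h n
    by (rule rep_count_stable) (use that A Hcd nonneg in auto)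
  have high: "rep_count A' h n = rep_count A' H n" if "c' + d' \<le> int h" "n \<le> d'" for h n
    by (rule rep_count_stable) (use that A Hcd nonneg in \<open>auto simp: A'_def\<close>)
  have "sumset_mult h A t = C \<union> {int c..int h * m - int d} \<union> (\<lambda>x. int h * m - x) ` D"
    if h: "c' + d' \<le> int h" for h
  proof (rule set_eqI)
    fix n
    define N where "N = int h * m"
    have N: "c' + d' \<le> N" using h h_le[of h] by (simp add: N_def)
    have inC: "0 \<le> n \<and> n \<le> int c - 2" if "n \<in> C" using that C(2) by auto
    have inD: "0 \<le> N - n \<and> N - n \<le> int d - 2" if "N - n \<in> D" using that D(2) by auto
    have "t \<le> rep_count A h n \<longleftrightarrow> n \<in> C \<or> int c \<le> n \<and> n \<le> N - int d \<or> N - n \<in> D"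
    proof -
      \<comment> \<open>Since \<open>int c \<le> c'\<close>, \<open>int d \<le> d'\<close> and
        \<open>c' + d' \<le> N\<close>, the set \<open>C\<close> lies below \<open>c'\<close> and
        the reflected \<open>D\<close> above \<open>N - d'\<close>; neither end interferes with the
        other.\<close>
      consider "n \<notin> {0..N}" | "n \<in> {0..c'}" | "c' \<le> n" "n \<le> N - d'" | "N - n \<in> {0..d'}"
        by fastforce
      then show ?thesis
      proof cases
        case 1
        then have "rep_count A h n = 0"
          using rep_count_eq_0[OF A(4)] by (simp add: N_def)
        then show ?thesis
          using 1 inC inD C(3) D(3) N nonneg \<open>1 \<le> t\<close> by auto
      next
        case 2
        then have "t \<le> rep_count A h n \<longleftrightarrow> n \<in> C \<or> int c \<le> n"
          using C(4) low[OF h] by auto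
        then show ?thesis using 2 inD C(3) D(3) N by auto
      next
        case 3
        then show ?thesis using middle[of n h] C(3) D(3) by (auto simp: N_def)
      next
        case 4
        then have "t \<le> rep_count A h n \<longleftrightarrow> N - n \<in> D \<or> int d \<le> N - n"
          using D(4) high[OF h, of "N - n"] by (auto simp: reflect N_def)
        then show ?thesis using 4 inC C(3) D(3) N by auto
      qed
    qed
    moreover have "n \<in> (\<lambda>x. N - x) ` D \<longleftrightarrow> N - n \<in> D"
      by (metis (no_types, lifting) diff_diff_eq2 add_diff_cancel_left' image_iff)
    ultimately show "n \<in> sumset_mult h A t \<longleftrightarrow>
        n \<in> C \<union> {int c..int h * m - int d} \<union> (\<lambda>x. int h * m - x) ` D"
      unfolding sumset_mult_def N_def by auto
  qed
  then show ?thesis using C D by blast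
qed

theorem theorem2:
  fixes k :: nat and a :: "nat \<Rightarrow> int" and A :: "int set"
  assumes "k \<ge> 2"
    and "A = a ` {0..k}"
    and "a 0 = 0"
    and "strict_mono_on {0..k} a"
    and "Gcd A = 1"
  shows "\<forall>t::nat. t \<ge> 1 \<longrightarrow>
           (\<exists>(c::nat) (d::nat) (C::int set) (D::int set).
              finite C \<and> finite D \<and>
              C \<subseteq> {0..int c - 2} \<and> D \<subseteq> {0..int d - 2} \<and>
              (\<forall>h::nat. int h \<ge> (int k - 1) * (int t * a k - 1) * a k + 1 \<longrightarrow>
                 sumset_mult h A t =
                   C \<union> {int c..int h * a k - int d} \<union> (\<lambda>x. int h * a k - x) ` D))"
proof (intro allI impI)
  fix t :: nat assume t: "t \<ge> 1"
  define B where "B = A - {0, a k}"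
  have mono: "a i < a j" if "i < j" "j \<le> k" for i j
    using assms(4) that by (auto simp: strict_mono_on_def)
  have inj: "inj_on a {0..k}"
    using assms(4) by (rule strict_mono_on_imp_inj_on)
  have pos: "0 < a k" using mono[of 0 k] assms by simp
  have A: "finite A" "0 \<in> A" "a k \<in> A" "A \<subseteq> {0..a k}"
    using assms(2,3) mono mono[of 0] by (auto simp: image_iff le_less) metis+
  \<comment> \<open>As \<open>k \<ge> 2\<close>, \<open>a 1\<close> lies strictly between 0 and
    \<open>a k\<close>.\<close>
  have "a 1 \<in> B"
    using mono[of 0 1] mono[of 1 k] assms by (auto simp: B_def)
  then have "B \<noteq> {}" by blast
  have "card A = k + 1" using card_image[OF inj] assms(2) by simp
  then have cardB: "int (card B) = int k - 1"
    using A pos assms(1) by (simp add: B_def card_Diff_subset)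
  \<comment> \<open>Each of the \<open>k - 1\<close> elements \<open>b\<close> contributes
    \<open>b + (a k - b) = a k\<close>. The total is one less than the threshold for
    \<open>h\<close> in the theorem.\<close>
  have sum: "(int t * a k - 1) * (\<Sum>b\<in>B. b) + (int t * a k - 1) * (\<Sum>b\<in>B. a k - b)
      = (int k - 1) * (int t * a k - 1) * a k"
    by (simp add: sum_subtractf cardB algebra_simps)
  obtain c d :: nat and C D where *: "finite C" "finite D"
      "C \<subseteq> {0..int c - 2}" "D \<subseteq> {0..int d - 2}"
      "\<forall>h::nat. (int k - 1) * (int t * a k - 1) * a k \<le> int h \<longrightarrow> sumset_mult h A t =
        C \<union> {int c..int h * a k - int d} \<union> (\<lambda>x. int h * a k - x) ` D"
    using sumset_mult_structure[OF A assms(5) pos _ t] \<open>B \<noteq> {}\<close>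
    unfolding B_def[symmetric] sum by blast
  show "\<exists>(c::nat) (d::nat) (C::int set) (D::int set).
              finite C \<and> finite D \<and>
              C \<subseteq> {0..int c - 2} \<and> D \<subseteq> {0..int d - 2} \<and>
              (\<forall>h::nat. int h \<ge> (int k - 1) * (int t * a k - 1) * a k + 1 \<longrightarrow>
                 sumset_mult h A t =
                   C \<union> {int c..int h * a k - int d} \<union> (\<lambda>x. int h * a k - x) ` D)"
    using * by (intro exI[of _ c] exI[of _ d] exI[of _ C] exI[of _ D]) auto
qed

end
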